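(* Let $I$ be a Borel ideal on $2^\omega$ with a $\Pi^1_2$ definition. Suppose there is a Borel function $f:2^\omega\to2^\omega$ and distinct points $x_\alpha\in 2^\omega$, $\alpha<\omega_2$, with $f^{-1}[\{x_\alpha\}]\notin I$ for each $\alpha$. Then there is a nonempty perfect set $P\subseteq 2^\omega$ such that $f^{-1}[\{x\}]\notin I$ for all $x\in P$. Consequently $I$ has property (M).
   Context: Ideals are assumed to contain all singletons and not to contain the whole space. A Borel ideal $I$ on $2^\omega$ has a $\Pi^1_2$ definition if there is a $\Pi^1_2$ formula $\Phi(x)$ such that $\Phi(a)$ holds iff $a$ is a Borel code and the set coded by $a$ belongs to $I$. Property (M): there is a Borel function $g:2^\omega\to2^\omega$ with $g^{-1}[\{x\}]\notin I$ for all $x$. *)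

theory Defs
  imports "HOL-Analysis.Analysis"
begin

text \<open>Cantor space 2^omega is nat => bool with the product topology (Function_Topology);
  Baire space omega^omega is nat => nat with the product of discrete topologies.\<close>

type_synonym cantor = "nat \<Rightarrow> bool"
type_synonym baire = "nat \<Rightarrow> nat"

definition sigma11 :: "'a::topological_space set \<Rightarrow> bool" where
  "sigma11 S \<longleftrightarrow> (\<exists>C :: ('a \<times> baire) set. closed C \<and> S = fst ` C)"

definition pi11 :: "'a::topological_space set \<Rightarrow> bool" where
  "pi11 S \<longleftrightarrow> sigma11 (- S)"

definition sigma12 :: "'a::topological_space set \<Rightarrow> bool" where
  "sigma12 S \<longleftrightarrow> (\<exists>T :: ('a \<times> baire) set. pi11 T \<and> S = fst ` T)"

definition pi12 :: "'a::topological_space set \<Rightarrow> bool" where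
  "pi12 S \<longleftrightarrow> sigma12 (- S)"

inductive bcode :: "cantor \<Rightarrow> cantor set \<Rightarrow> bool" where
  basic: "bcode (\<lambda>k. k = n + 2) {x. x n}"
| compl: "c 0 = True \<Longrightarrow> c 1 = False \<Longrightarrow> bcode (\<lambda>k. c (k + 2)) B \<Longrightarrow> bcode c (- B)"
| union: "c 0 = False \<Longrightarrow> c 1 = True \<Longrightarrow> (\<And>n. bcode (\<lambda>k. c (prod_encode (n, k) + 2)) (B n))
          \<Longrightarrow> bcode c (\<Union>n. B n)"

definition borel_ideal :: "cantor set set \<Rightarrow> bool" where
  "borel_ideal I \<longleftrightarrow>
     I \<subseteq> sets borel \<and>
     (\<forall>A\<in>I. \<forall>B\<in>sets borel. B \<subseteq> A \<longrightarrow> B \<in> I) \<and>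
     (\<forall>A\<in>I. \<forall>B\<in>I. A \<union> B \<in> I) \<and>
     (\<forall>x. {x} \<in> I) \<and>
     UNIV \<notin> I"

definition has_pi12_definition :: "cantor set set \<Rightarrow> bool" where
  "has_pi12_definition I \<longleftrightarrow> pi12 {a :: cantor. \<exists>B. bcode a B \<and> B \<in> I}"

definition perfect_set :: "'a::topological_space set \<Rightarrow> bool" where
  "perfect_set P \<longleftrightarrow> closed P \<and> (\<forall>x\<in>P. x islimpt P)"

definition property_M :: "cantor set set \<Rightarrow> bool" where
  "property_M I \<longleftrightarrow> (\<exists>g :: cantor \<Rightarrow> cantor. g \<in> borel_measurable borel \<and> (\<forall>x. g -` {x} \<notin> I))"

definition omega2 :: "(nat set set) rel" where
  "omega2 = cardSuc (cardSuc natLeq)"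

end

theory Submission
  imports Defs "HOL-Library.Countable_Set_Type"
begin

text \<open>Since \<open>f\<close> is Borel, a Borel code of the fibre of \<open>f\<close> over \<open>x\<close> can be chosen continuously in \<open>x\<close>,
  so the set of points whose fibre is not in \<open>I\<close> is a continuous preimage of a \<open>\<Sigma>\<^sup>1\<^sub>2\<close> set, hence itself
  \<open>\<Sigma>\<^sup>1\<^sub>2\<close>. A \<open>\<Sigma>\<^sup>1\<^sub>2\<close> set is a union of \<open>\<aleph>\<^sub>1\<close> analytic sets. As this one has at least \<open>\<aleph>\<^sub>2\<close> elements,
  one of these analytic sets is uncountable, and it contains the range of an embedding \<open>k\<close> of Cantor space.
  This range is the perfect set, and the inverse of \<open>k\<close> composed with \<open>f\<close> witnesses property (M).\<close>

section \<open>Agreement on initial segments and the topology of sequence spaces\<close>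

text \<open>Cantor space is compact and Hausdorff because its finite discrete factors are, so
  continuous self-maps are closed maps. This makes images of closed sets Borel later on.\<close>

lemma closed_image_cantor:
  fixes k :: "cantor \<Rightarrow> cantor"
  assumes "continuous_on UNIV k" "closed D"
  shows "closed (k ` D)"
proof -
  let ?P = "product_topology (\<lambda>i::nat. euclidean :: bool topology) UNIV"
  have fin: "compact_space (euclidean :: bool topology)"
    by (simp add: compact_space_def finite_imp_compact)
  have haus: "Hausdorff_space (euclidean :: bool topology)"
    by (simp add: Hausdorff_space_def disjnt_def) (metis hausdorff)
  have "compact_space ?P"
    unfolding compact_space_product_topology using fin by blast
  moreover have "Hausdorff_space ?P"
    unfolding Hausdorff_space_product_topology using haus by blast
  ultimately have "compact_space (euclidean :: cantor topology)" "Hausdorff_space (euclidean :: cantor topology)"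
    unfolding euclidean_product_topology .
  then have "closed_map (euclidean :: cantor topology) (euclidean :: cantor topology) k"
    using assms(1) T1_Spaces.continuous_imp_closed_map continuous_map_iff_continuous2 by blast
  then show ?thesis
    using assms(2) by (simp add: closed_map_def)
qed

lemma open_agree_below:
  fixes x :: "nat \<Rightarrow> 'a::discrete_topology"
  shows "open {y. \<forall>i<n. y i = x i}"
proof -
  have "open ((\<lambda>z::nat \<Rightarrow> 'a. z i) -` {x i})" for i
    by (rule open_vimage) (auto intro: open_discrete)
  then have "open (\<Inter>i\<in>{..<n}. (\<lambda>z::nat \<Rightarrow> 'a. z i) -` {x i})"
    by (intro open_INT) auto
  also have "(\<Inter>i\<in>{..<n}. (\<lambda>z::nat \<Rightarrow> 'a. z i) -` {x i}) = {y. \<forall>i<n. y i = x i}"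
    by auto
  finally show ?thesis .
qed

text \<open>A basic open set of the product restricts only finitely many coordinates, and these all
  lie below some \<open>n\<close>.\<close>

lemma open_imp_agree_below:
  fixes x :: "nat \<Rightarrow> 'a::topological_space"
  assumes "open S" "x \<in> S"
  obtains n where "\<And>y. (\<forall>i<n. y i = x i) \<Longrightarrow> y \<in> S"
proof -
  have "openin (product_topology (\<lambda>i::nat. euclidean :: 'a topology) UNIV) S"
    using assms(1) by (simp add: open_fun_def)
  then obtain X where X: "x \<in> Pi\<^sub>E UNIV X" "finite {i. X i \<noteq> topspace (euclidean :: 'a topology)}"
      "Pi\<^sub>E UNIV X \<subseteq> S"
    using product_topology_open_contains_basis[OF _ assms(2)] by blast
  then obtain n where n: "{i. X i \<noteq> UNIV} \<subseteq> {..<n}"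
    using finite_nat_iff_bounded by auto
  show thesis
  proof (rule that)
    fix y assume "\<forall>i<n. y i = x i"
    then have "y i \<in> X i" for i
      using X(1) n by (cases "X i = UNIV") (auto simp: PiE_iff subset_iff)
    then show "y \<in> S" using X(3) by (auto simp: PiE_iff)
  qed
qed

lemma continuous_on_locally_constant:
  fixes F :: "(nat \<Rightarrow> 'a::discrete_topology) \<Rightarrow> 'b::topological_space"
  assumes "\<And>x. \<exists>n. \<forall>y. (\<forall>i<n. y i = x i) \<longrightarrow> F y = F x"
  shows "continuous_on UNIV F"
proof (subst continuous_on_open_vimage[OF open_UNIV], intro allI impI)
  fix B :: "'b set" assume "open B"
  show "open (F -` B \<inter> UNIV)"
  proof (subst open_subopen, intro ballI)
    fix x assume x: "x \<in> F -` B \<inter> UNIV"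
    obtain n where n: "\<forall>y. (\<forall>i<n. y i = x i) \<longrightarrow> F y = F x"
      using assms by blast
    have "{y. \<forall>i<n. y i = x i} \<subseteq> F -` B \<inter> UNIV"
    proof
      fix y assume "y \<in> {y. \<forall>i<n. y i = x i}"
      then have "F y = F x" using n by blast
      then show "y \<in> F -` B \<inter> UNIV" using x by simp
    qed
    moreover have "x \<in> {y. \<forall>i<n. y i = x i}" by simp
    ultimately show "\<exists>T. open T \<and> x \<in> T \<and> T \<subseteq> F -` B \<inter> UNIV"
      using open_agree_below[of n x] by blast
  qed
qed

text \<open>Products of two cylinders of a common length form a base here, since all factors are
  discrete. Closedness is thereby a statement about finite approximations; it serves both to find
  limits of branches and to prove sets closed.\<close>

lemma closed_prod_iff_agree_below:
  fixes Q :: "((nat \<Rightarrow> 'a::discrete_topology) \<times> (nat \<Rightarrow> 'b::discrete_topology)) set"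
  shows "closed Q \<longleftrightarrow> (\<forall>x y. (\<forall>n. \<exists>x' y'. (x', y') \<in> Q \<and> (\<forall>i<n. x' i = x i \<and> y' i = y i)) \<longrightarrow> (x, y) \<in> Q)"
    (is "_ \<longleftrightarrow> ?R")
proof
  assume cl: "closed Q"
  show ?R
  proof (intro allI impI, rule ccontr)
    fix x y
    assume app: "\<forall>n. \<exists>x' y'. (x', y') \<in> Q \<and> (\<forall>i<n. x' i = x i \<and> y' i = y i)"
      and notin: "(x, y) \<notin> Q"
    obtain U V where UV: "open U" "open V" "(x, y) \<in> U \<times> V" "U \<times> V \<subseteq> - Q"
      by (rule open_prod_elim[OF open_Compl[OF cl] notin[folded Compl_iff]])
    obtain n where n: "\<And>x'. (\<forall>i<n. x' i = x i) \<Longrightarrow> x' \<in> U"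
      using open_imp_agree_below[of U x] UV by blast
    obtain m where m: "\<And>y'. (\<forall>i<m. y' i = y i) \<Longrightarrow> y' \<in> V"
      using open_imp_agree_below[of V y] UV by blast
    obtain x' y' where "(x', y') \<in> Q" "\<forall>i<max n m. x' i = x i \<and> y' i = y i"
      using app by blast
    then show False using n[of x'] m[of y'] UV(4) by auto
  qed
next
  assume R: ?R
  show "closed Q"
    unfolding closed_def
  proof (subst open_subopen, intro ballI)
    fix p assume "p \<in> - Q"
    moreover obtain x y where p: "p = (x, y)" by fastforce
    ultimately have "(x, y) \<notin> Q" by simp
    then have "\<not> (\<forall>n. \<exists>x' y'. (x', y') \<in> Q \<and> (\<forall>i<n. x' i = x i \<and> y' i = y i))"
      by (rule contrapos_nn) (rule R[THEN spec, THEN spec, THEN mp])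
    then obtain n where n: "\<not> (\<exists>x' y'. (x', y') \<in> Q \<and> (\<forall>i<n. x' i = x i \<and> y' i = y i))"
      by blast
    have "open ({x'. \<forall>i<n. x' i = x i} \<times> {y'. \<forall>i<n. y' i = y i})"
      by (intro open_Times open_agree_below)
    moreover have "{x'. \<forall>i<n. x' i = x i} \<times> {y'. \<forall>i<n. y' i = y i} \<subseteq> - Q"
      using n by blast
    moreover have "p \<in> {x'. \<forall>i<n. x' i = x i} \<times> {y'. \<forall>i<n. y' i = y i}"
      using p by simp
    ultimately show "\<exists>T. open T \<and> p \<in> T \<and> T \<subseteq> - Q"
      by blast
  qed
qed

lemma closed_prod3_imp_agree_below:
  fixes C :: "(((nat \<Rightarrow> 'a::topological_space) \<times> (nat \<Rightarrow> 'b::topological_space)) \<times> (nat \<Rightarrow> 'c::topological_space)) set"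
  assumes cl: "closed C"
    and app: "\<And>n. \<exists>x' y' z'. ((x', y'), z') \<in> C \<and> (\<forall>i<n. x' i = x i \<and> y' i = y i \<and> z' i = z i)"
  shows "((x, y), z) \<in> C"
proof (rule ccontr)
  assume notin: "((x, y), z) \<notin> C"
  obtain U W where UW: "open U" "open W" "((x, y), z) \<in> U \<times> W" "U \<times> W \<subseteq> - C"
    by (rule open_prod_elim[OF open_Compl[OF cl] notin[folded Compl_iff]])
  obtain X Y where XY: "open X" "open Y" "(x, y) \<in> X \<times> Y" "X \<times> Y \<subseteq> U"
    by (rule open_prod_elim[OF UW(1)]) (use UW(3) in auto)
  obtain n where n: "\<And>x'. (\<forall>i<n. x' i = x i) \<Longrightarrow> x' \<in> X"
    using open_imp_agree_below[of X x] XY by blast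
  obtain m where m: "\<And>y'. (\<forall>i<m. y' i = y i) \<Longrightarrow> y' \<in> Y"
    using open_imp_agree_below[of Y y] XY by blast
  obtain k where k: "\<And>z'. (\<forall>i<k. z' i = z i) \<Longrightarrow> z' \<in> W"
    using open_imp_agree_below[of W z] UW by blast
  obtain x' y' z' where "((x', y'), z') \<in> C" "\<forall>i<max n (max m k). x' i = x i \<and> y' i = y i \<and> z' i = z i"
    using app by blast
  moreover from this have "((x', y'), z') \<in> U \<times> W"
    using n[of x'] m[of y'] k[of z'] XY(4) by auto
  ultimately show False using UW(4) by blast
qed

section \<open>The perfect set theorem for analytic sets\<close>

text \<open>Properly extending finite sequences converge to an infinite one. Lengths grow by at
  least one per step, so \<open>s (Suc i)\<close> already has an entry at \<open>i\<close>, and this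
  entry never changes afterwards.\<close>

lemma nth_increasing_chain:
  fixes s :: "nat \<Rightarrow> 'a list"
  assumes less: "\<And>n. length (s n) < length (s (Suc n))"
    and take: "\<And>n. take (length (s n)) (s (Suc n)) = s n"
  shows "n \<le> length (s n)"
    and "i < length (s n) \<Longrightarrow> s n ! i = s (Suc i) ! i"
proof -
  show le: "n \<le> length (s n)" for n
  proof (induction n)
    case (Suc n)
    then show ?case using less[of n] by linarith
  qed simp
  have ext: "i < length (s n) \<and> s n ! i = s m ! i" if "m \<le> n" "i < length (s m)" for m n i
    using that(1)
  proof (induction n rule: dec_induct)
    case base
    then show ?case using that(2) by simp
  next
    case (step n)
    then have "s (Suc n) ! i = s n ! i"
      by (metis nth_take take)
    then show ?case using step less[of n] by simp
  qed
  show "s n ! i = s (Suc i) ! i" if "i < length (s n)"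
  proof (cases "n \<le> Suc i")
    case True
    then show ?thesis using ext that by metis
  next
    case False
    then show ?thesis using ext[of "Suc i" n i] le[of "Suc i"] by simp
  qed
qed

lemma continuous_on_finite_dependence:
  fixes k :: "(nat \<Rightarrow> 'a::discrete_topology) \<Rightarrow> nat \<Rightarrow> 'b::topological_space"
  assumes "\<And>i. \<exists>n. \<forall>x y. (\<forall>j<n. y j = x j) \<longrightarrow> k y i = k x i"
  shows "continuous_on UNIV k"
  by (rule continuous_on_coordinatewise_then_product, rule continuous_on_locally_constant)
    (use assms in meson)

text \<open>The scheme: a node is a finite approximation of a point of the closed set, and it is kept
  only if the part of \<open>S\<close> below it is uncountable. Discarding the countably many countable parts shows
  that every kept node has two kept extensions that already differ in the first coordinate.\<close>

theorem sigma11_uncountable_imp_cantor_embedding: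
  fixes S :: "cantor set"
  assumes "sigma11 S" "uncountable S"
  obtains k :: "cantor \<Rightarrow> cantor" where "continuous_on UNIV k" "inj k" "range k \<subseteq> S"
proof -
  obtain Q :: "(cantor \<times> baire) set" where Q: "closed Q" "S = fst ` Q"
    using assms(1) unfolding sigma11_def by blast
  \<comment> \<open>A node \<open>w\<close> prescribes initial segments of both the point and its
    witness, so limits of branches stay in \<open>Q\<close>. Only the points are collected, since
    the size of \<open>S\<close> is at issue.\<close>
  define N where "N w = {x. \<exists>y. (x, y) \<in> Q \<and> (\<forall>i<length w. (x i, y i) = w ! i)}" for w
  have split: "\<exists>w0 w1. length w < length w0 \<and> length w1 = length w0 \<and>
      take (length w) w0 = w \<and> take (length w) w1 = w \<and>
      uncountable (N w0) \<and> uncountable (N w1) \<and> map fst w0 \<noteq> map fst w1"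
    if "uncountable (N w)" for w
  proof -
    \<comment> \<open>There are only countably many lists \<open>v\<close>. For a point of
      \<open>K\<close>, every node it passes through together with any witness is therefore
      uncountable.\<close>
    define K where "K = N w - (\<Union>v\<in>{v. countable (N v)}. N v)"
    have "countable (\<Union>v\<in>{v. countable (N v)}. N v)"
      by (rule countable_UN) auto
    then have "uncountable K"
      unfolding K_def using that uncountable_minus_countable by blast
    then obtain x where x: "x \<in> K"
      by fastforce
    have "uncountable (K - {x})"
      using \<open>uncountable K\<close> by (simp add: uncountable_minus_countable)
    then obtain x' where x': "x' \<in> K" "x' \<noteq> x"
      by (metis Diff_iff countable_empty ex_in_conv insertI1)
    obtain j where j: "x j \<noteq> x' j"
      using x'(2) by (auto simp: fun_eq_iff)
    obtain y where y: "(x, y) \<in> Q" "\<forall>i<length w. (x i, y i) = w ! i"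
      using x unfolding K_def N_def by auto
    obtain y' where y': "(x', y') \<in> Q" "\<forall>i<length w. (x' i, y' i) = w ! i"
      using x' unfolding K_def N_def by auto
    \<comment> \<open>Long enough both to extend \<open>w\<close> properly and to show the
      coordinate \<open>j\<close> that separates \<open>x\<close> from \<open>x'\<close>.\<close>
    define m where "m = Suc (max (length w) j)"
    define w0 where "w0 = map (\<lambda>i. (x i, y i)) [0..<m]"
    define w1 where "w1 = map (\<lambda>i. (x' i, y' i)) [0..<m]"
    have m: "length w < m" "j < m" by (auto simp: m_def)
    have "x \<in> N w0" unfolding N_def w0_def using y(1) by auto
    then have "uncountable (N w0)" using x unfolding K_def by auto
    moreover have "x' \<in> N w1" unfolding N_def w1_def using y'(1) by auto
    then have "uncountable (N w1)" using x' unfolding K_def by auto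
    moreover have "take (length w) w0 = w"
      using y(2) m by (intro nth_equalityI) (auto simp: w0_def)
    moreover have "take (length w) w1 = w"
      using y'(2) m by (intro nth_equalityI) (auto simp: w1_def)
    moreover have "map fst w0 ! j \<noteq> map fst w1 ! j"
      using m j by (simp add: w0_def w1_def)
    then have "map fst w0 \<noteq> map fst w1" by metis
    moreover have "length w < length w0" "length w1 = length w0"
      using m(1) by (simp_all add: w0_def w1_def)
    ultimately show ?thesis by metis
  qed
  then have "\<exists>g0 g1. \<forall>w. uncountable (N w) \<longrightarrow> length w < length (g0 w) \<and> length (g1 w) = length (g0 w) \<and>
      take (length w) (g0 w) = w \<and> take (length w) (g1 w) = w \<and>
      uncountable (N (g0 w)) \<and> uncountable (N (g1 w)) \<and> map fst (g0 w) \<noteq> map fst (g1 w)"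
    by metis
  then obtain g0 g1 where g: "\<And>w. uncountable (N w) \<Longrightarrow> length w < length (g0 w) \<and> length (g1 w) = length (g0 w) \<and>
      take (length w) (g0 w) = w \<and> take (length w) (g1 w) = w \<and>
      uncountable (N (g0 w)) \<and> uncountable (N (g1 w)) \<and> map fst (g0 w) \<noteq> map fst (g1 w)"
    by metis
  define s where "s b n = rec_nat [] (\<lambda>n w. if b n then g1 w else g0 w) n" for b :: cantor and n
  have s_0: "s b 0 = []" and s_Suc: "s b (Suc n) = (if b n then g1 (s b n) else g0 (s b n))" for b n
    by (simp_all add: s_def)
  have unc: "uncountable (N (s b n))" for b n
  proof (induction n)
    case 0
    have "N [] = S" unfolding N_def Q(2) by force
    then show ?case using assms(2) by (simp add: s_0)
  next
    case (Suc n)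
    then show ?case using g by (simp add: s_Suc)
  qed
  have less: "length (s b n) < length (s b (Suc n))"
    and take: "take (length (s b n)) (s b (Suc n)) = s b n" for b n
    using g[OF unc] by (simp_all add: s_Suc)
  have same: "s b n = s b' n" if "\<forall>i<n. b' i = b i" for b b' n
    using that by (induction n) (simp_all add: s_0 s_Suc)
  \<comment> \<open>Stage \<open>Suc i\<close> depends only on the bits of \<open>b\<close> up to
    \<open>i\<close>, which gives continuity of \<open>k\<close>.\<close>
  define k where "k b i = fst (s b (Suc i) ! i)" for b i
  define l where "l b i = snd (s b (Suc i) ! i)" for b i
  have nth: "s b n ! i = (k b i, l b i)" if "i < length (s b n)" for b n i
    using nth_increasing_chain(2)[of "s b", OF less take that] by (simp add: k_def l_def)
  have inQ: "(k b, l b) \<in> Q" for b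
  proof (rule closed_prod_iff_agree_below[THEN iffD1, OF Q(1), rule_format])
    fix n
    have "N (s b n) \<noteq> {}" using unc by (metis countable_empty)
    then obtain x' y' where xy: "(x', y') \<in> Q" "\<forall>i<length (s b n). (x' i, y' i) = s b n ! i"
      unfolding N_def by blast
    have "x' i = k b i \<and> y' i = l b i" if "i < n" for i
    proof -
      have "i < length (s b n)"
        using that nth_increasing_chain(1)[of "s b" n, OF less take] by linarith
      then show ?thesis using xy(2) nth by simp
    qed
    then show "\<exists>x' y'. (x', y') \<in> Q \<and> (\<forall>i<n. x' i = k b i \<and> y' i = l b i)"
      using xy(1) by blast
  qed
  show thesis
  proof
    show "continuous_on UNIV k"
    proof (rule continuous_on_finite_dependence)
      fix i
      show "\<exists>n. \<forall>x y. (\<forall>j<n. y j = x j) \<longrightarrow> k y i = k x i"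
        unfolding k_def using same by (intro exI[of _ "Suc i"] allI impI) metis
    qed
    show "inj k"
    proof (rule injI, rule ccontr)
      fix b b' assume eq: "k b = k b'" and "b \<noteq> b'"
      then have "\<exists>j. b j \<noteq> b' j" by (simp only: fun_eq_iff not_all)
      \<comment> \<open>At the first difference the two branches leave a common node for its two
        children, whose first coordinates differ.\<close>
      then obtain n where n: "b n \<noteq> b' n" "\<And>i. i < n \<Longrightarrow> b i = b' i"
        unfolding exists_least_iff[of "\<lambda>j. b j \<noteq> b' j"] by blast
      have same_n: "s b n = s b' n" using n(2) by (intro same) simp
      have len: "length (s b (Suc n)) = length (s b' (Suc n))"
        and ne: "map fst (s b (Suc n)) \<noteq> map fst (s b' (Suc n))"
        using g[OF unc, of b n] g[OF unc, of b' n] n(1) same_n by (auto simp: s_Suc)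
      have "map fst (s b (Suc n)) = map fst (s b' (Suc n))"
        using len eq by (intro nth_equalityI) (auto simp: nth)
      with ne show False by simp
    qed
    show "range k \<subseteq> S"
      using inQ unfolding Q(2) by (auto simp: image_iff) (metis fst_conv)
  qed
qed

section \<open>\<open>\<Sigma>\<^sup>1\<^sub>2\<close> sets as unions of analytic sets\<close>

abbreviation omega1 :: "nat set rel" where
  "omega1 \<equiv> cardSuc natLeq"

lemma Card_order_omega1: "Card_order omega1"
  by (simp add: cardSuc_Card_order natLeq_Card_order)

lemma infinite_Field_omega1: "infinite (Field omega1)"
  unfolding cardSuc_finite[OF natLeq_Card_order] by (simp add: Field_natLeq)

lemma Well_order_omega1: "Well_order omega1"
  using Card_order_omega1 by (rule card_order_on_well_order_on)

lemma wf_omega1: "wf (omega1 - Id)"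
  using Well_order_omega1 by (simp add: well_order_on_def)

text \<open>This is regularity of \<open>omega1\<close>: a countable set without a strict upper
  bound would be cofinal, hence of the cardinality of \<open>omega1\<close>.\<close>

lemma countable_bounded_omega1:
  assumes "countable K" "K \<subseteq> Field omega1"
  shows "\<exists>a\<in>Field omega1. \<forall>b\<in>K. (b, a) \<in> omega1 - Id"
proof (rule ccontr)
  assume contra: "\<not> ?thesis"
  have "cofinal K omega1"
    unfolding cofinal_def
  proof
    fix a assume a: "a \<in> Field omega1"
    \<comment> \<open>Unboundedness yields only a weak inequality between \<open>a'\<close> and some
      \<open>b\<close> in \<open>K\<close>. Starting from \<open>a'\<close> strictly above
      \<open>a\<close> makes \<open>b\<close> strictly above \<open>a\<close>, as cofinality
      demands.\<close>
    then obtain a' where a': "a' \<in> Field omega1" "a \<noteq> a'" "(a, a') \<in> omega1"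
      using infinite_Card_order_limit[OF Card_order_omega1 infinite_Field_omega1] by blast
    then obtain b where b: "b \<in> K" "(b, a') \<notin> omega1 - Id"
      using contra by blast
    have lin: "Linear_order omega1" using Well_order_omega1 by (simp add: well_order_on_def)
    have "(a', b) \<in> omega1"
    proof (cases "b = a'")
      case True
      have "refl_on (Field omega1) omega1"
        using lin by (simp add: order_on_defs)
      then show ?thesis using a'(1) True by (simp add: refl_onD)
    next
      case False
      have "b \<in> Field omega1" using b(1) assms(2) by (rule subsetD[rotated])
      moreover have "total_on (Field omega1) omega1"
        using lin by (simp add: order_on_defs)
      ultimately have "(b, a') \<in> omega1 \<or> (a', b) \<in> omega1"
        using a'(1) False by (simp add: total_on_def)
      then show ?thesis using b(2) False by simp
    qed
    moreover have "trans omega1" "antisym omega1"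
      using lin by (simp_all add: order_on_defs)
    ultimately have "a \<noteq> b \<and> (a, b) \<in> omega1"
      using a' by (metis antisymD transD)
    then show "\<exists>b\<in>K. a \<noteq> b \<and> (a, b) \<in> omega1" using b(1) by blast
  qed
  moreover have "regularCard omega1"
    using infinite_cardSuc_regularCard[OF _ natLeq_Card_order] by (simp add: Field_natLeq)
  ultimately have "(card_of K, omega1) \<in> ordIso"
    using assms(2) unfolding regularCard_def by blast
  moreover have "(card_of K, omega1) \<in> ordLess"
    using assms(1) countable_card_le_natLeq cardSuc_greater[OF natLeq_Card_order] ordLeq_ordLess_trans
    by blast
  ultimately show False
    using not_ordLess_ordIso by blast
qed

lemma countable_underS_omega1:
  assumes "a \<in> Field omega1"
  shows "countable (underS omega1 a)"
  using card_of_underS[OF Card_order_omega1 assms]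
  unfolding countable_card_le_natLeq cardSuc_ordLeq_ordLess[OF natLeq_Card_order card_of_Card_order] .

text \<open>Well-founded recursion sends \<open>s\<close> to a chosen strict upper bound of the
  values at its predecessors. Such a bound exists because the type is countable; the same bounding
  argument applied to the range of \<open>h\<close> gives \<open>a\<close>.\<close>

lemma wf_rank_omega1:
  fixes R :: "'k::countable rel"
  assumes "wf R"
  obtains h a where "a \<in> Field omega1" "\<And>s. h s \<in> underS omega1 a"
    "\<And>s t. (t, s) \<in> R \<Longrightarrow> (h t, h s) \<in> omega1 - Id"
proof -
  define F where "F f s = (SOME a. a \<in> Field omega1 \<and> (\<forall>b\<in>f ` {t. (t, s) \<in> R}. (b, a) \<in> omega1 - Id))"
    for f and s :: 'k
  define h where "h = wfrec R F"
  have h: "h s = F h s" for s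
  proof -
    have "cut h R s ` {t. (t, s) \<in> R} = h ` {t. (t, s) \<in> R}"
      by (rule image_cong) (simp_all add: cut_apply)
    then have "F (cut h R s) s = F h s" unfolding F_def by simp
    then show ?thesis unfolding h_def by (subst wfrec[OF assms]) simp
  qed
  have *: "h s \<in> Field omega1 \<and> (\<forall>b\<in>h ` {t. (t, s) \<in> R}. (b, h s) \<in> omega1 - Id)" for s
  proof (induction s rule: wf_induct_rule[OF assms])
    case (1 s)
    have "\<exists>a\<in>Field omega1. \<forall>b\<in>h ` {t. (t, s) \<in> R}. (b, a) \<in> omega1 - Id"
      by (rule countable_bounded_omega1) (use 1 in auto)
    from someI_ex[OF this[unfolded Bex_def]] show ?case
      unfolding F_def[symmetric] h[symmetric] .
  qed
  have "\<exists>a\<in>Field omega1. \<forall>b\<in>range h. (b, a) \<in> omega1 - Id"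
    by (rule countable_bounded_omega1) (use * in auto)
  then obtain a where a: "a \<in> Field omega1" "\<And>s. (h s, a) \<in> omega1 - Id"
    by (metis rangeI)
  show thesis
  proof
    show "h s \<in> underS omega1 a" for s
      using a(2)[of s] by (simp add: underS_def)
    show "(h t, h s) \<in> omega1 - Id" if "(t, s) \<in> R" for s t
      using * that by blast
  qed (rule a(1))
qed

text \<open>Shoenfield's tree argument: membership in the complement of a projection means that the tree of
  attempts to find a witness is well-founded, i.e. ranked by some countable ordinal \<open>a\<close>; for
  fixed \<open>a\<close>, coded by an enumeration of its elements, being ranked by \<open>a\<close> is a closed condition on
  the point, the outer witness and the ranking.\<close>

theorem sigma12_eq_Union_sigma11:
  fixes S :: "cantor set"
  assumes "sigma12 S"
  obtains Y :: "nat set \<Rightarrow> cantor set" where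
    "\<And>a. sigma11 (Y a)" "S = (\<Union>a\<in>Field omega1. Y a)"
proof -
  obtain T where T: "pi11 T" "S = fst ` (T :: (cantor \<times> baire) set)"
    using assms unfolding sigma12_def by blast
  obtain C :: "((cantor \<times> baire) \<times> baire) set" where C: "closed C" "- T = fst ` C"
    using T(1) unfolding pi11_def sigma11_def by blast
  have S_iff: "x \<in> S \<longleftrightarrow> (\<exists>y. \<forall>z. ((x, y), z) \<notin> C)" for x
  proof -
    have "(x, y) \<in> T \<longleftrightarrow> (x, y) \<notin> fst ` C" for y
      using C(2) by (metis ComplD ComplI)
    then have "(x, y) \<in> T \<longleftrightarrow> (\<forall>z. ((x, y), z) \<notin> C)" for y
      by (auto simp: image_iff)
    moreover have "x \<in> S \<longleftrightarrow> (\<exists>y. (x, y) \<in> T)"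
      unfolding T(2) by force
    ultimately show ?thesis by simp
  qed
  \<comment> \<open>The tree of attempts at a witness \<open>z\<close>. Membership in
    \<open>C\<close> is tested only to depth \<open>length s\<close>, so \<open>B\<close> reads
    finitely many entries of \<open>x\<close> and \<open>y\<close>.\<close>
  define B where "B x y s \<longleftrightarrow> (\<exists>x' y' z'. ((x', y'), z') \<in> C \<and>
      (\<forall>i<length s. x' i = x i \<and> y' i = y i \<and> z' i = s ! i))" for x y s
  \<comment> \<open>An infinite descending chain is an infinite branch of the tree, and its limit
    yields a point of the closed set \<open>C\<close>.\<close>
  define R where "R x y = {(s @ [m], s) | s m. B x y (s @ [m])}" for x y
  have wf_R: "wf (R x y) \<longleftrightarrow> (\<forall>z. ((x, y), z) \<notin> C)" for x y
  proof -
    have "\<not> wf (R x y)" if "((x, y), z) \<in> C" for z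
    proof -
      have "B x y (map z [0..<Suc n])" for n
        unfolding B_def
        by (rule exI[of _ x], rule exI[of _ y], rule exI[of _ z]) (simp add: that del: upt_Suc)
      then have "(map z [0..<Suc n], map z [0..<n]) \<in> R x y" for n
        by (simp add: R_def)
      then show ?thesis
        unfolding wf_iff_no_infinite_down_chain by (auto intro!: exI[of _ "\<lambda>n. map z [0..<n]"])
    qed
    moreover have "\<exists>z. ((x, y), z) \<in> C" if not_wf: "\<not> wf (R x y)"
    proof -
      obtain s where s: "\<And>n. (s (Suc n), s n) \<in> R x y"
        using not_wf unfolding wf_iff_no_infinite_down_chain by blast
      have less: "length (s n) < length (s (Suc n))" and take: "take (length (s n)) (s (Suc n)) = s n"
        and B: "B x y (s (Suc n))" for n
        using s[of n] by (auto simp: R_def)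
      define z where "z i = s (Suc i) ! i" for i
      have "((x, y), z) \<in> C"
      proof (rule closed_prod3_imp_agree_below[OF C(1)])
        fix n
        have len: "n \<le> length (s (Suc n))"
          using nth_increasing_chain(1)[of s "Suc n", OF less take] by simp
        obtain x' y' z' where *: "((x', y'), z') \<in> C"
            "\<forall>i<length (s (Suc n)). x' i = x i \<and> y' i = y i \<and> z' i = s (Suc n) ! i"
          using B[of n] unfolding B_def by blast
        have "s (Suc n) ! i = z i" if "i < length (s (Suc n))" for i
          using nth_increasing_chain(2)[of s, OF less take that] by (simp add: z_def)
        then have "\<forall>i<n. x' i = x i \<and> y' i = y i \<and> z' i = z i"
          using *(2) len by simp
        then show "\<exists>x' y' z'. ((x', y'), z') \<in> C \<and> (\<forall>i<n. x' i = x i \<and> y' i = y i \<and> z' i = z i)"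
          using *(1) by blast
      qed
      then show ?thesis by blast
    qed
    ultimately show ?thesis by blast
  qed
  \<comment> \<open>Enumerating the countable segment below \<open>a\<close> lets a ranking take
    natural numbers as values, so that it becomes part of a point of Baire space.\<close>
  define d where "d a = from_nat_into (underS omega1 a)" for a
  \<comment> \<open>One sequence \<open>w\<close> carries the outer witness on its even entries and
    the coded ranking of finite sequences on its odd ones.\<close>
  define py where "py w n = w (2 * n)" for w :: baire and n :: nat
  define ph where "ph w s = w (2 * to_nat s + 1)" for w :: baire and s :: "nat list"
  define Q where "Q a = {(x, w). \<forall>s m. B x (py w) (s @ [m]) \<longrightarrow>
      (d a (ph w (s @ [m])), d a (ph w s)) \<in> omega1 - Id}" for a
  have Q_iff: "(x, w) \<in> Q a \<longleftrightarrow> (\<forall>(t, s)\<in>R x (py w). (d a (ph w t), d a (ph w s)) \<in> omega1 - Id)" for x w a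
    unfolding Q_def R_def by auto
  have closed_Q: "closed (Q a)" for a
    unfolding closed_prod_iff_agree_below
  proof (intro allI impI)
    fix x w
    assume app: "\<forall>n. \<exists>x' w'. (x', w') \<in> Q a \<and> (\<forall>i<n. x' i = x i \<and> w' i = w i)"
    show "(x, w) \<in> Q a"
      unfolding Q_def mem_Collect_eq case_prod_conv
    proof (intro allI impI)
      fix s m assume B: "B x (py w) (s @ [m])"
      \<comment> \<open>This exceeds every position that is read: those of \<open>x\<close> and
        \<open>py w\<close> below \<open>length (s @ [m])\<close>, and the odd positions holding the
        ranks of \<open>s\<close> and \<open>s @ [m]\<close>.\<close>
      define n where "n = 2 * (length (s @ [m]) + to_nat s + to_nat (s @ [m])) + 2"
      obtain x' w' where Q': "(x', w') \<in> Q a" and agree: "\<And>i. i < n \<Longrightarrow> x' i = x i \<and> w' i = w i"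
        using app by blast
      have "x' i = x i \<and> py w' i = py w i" if "i < length (s @ [m])" for i
        using that agree[of i] agree[of "2 * i"] by (simp add: py_def n_def)
      then have "B x' (py w') (s @ [m])"
        using B unfolding B_def by auto
      moreover have "ph w' s = ph w s" "ph w' (s @ [m]) = ph w (s @ [m])"
        using agree by (simp_all add: ph_def n_def)
      ultimately show "(d a (ph w (s @ [m])), d a (ph w s)) \<in> omega1 - Id"
        using Q'[unfolded Q_def mem_Collect_eq case_prod_conv, THEN spec, THEN spec, of s m] by simp
    qed
  qed
  show thesis
  proof
    show "sigma11 (fst ` Q a)" for a
      unfolding sigma11_def using closed_Q by blast
    show "S = (\<Union>a\<in>Field omega1. fst ` Q a)"
    proof (intro set_eqI iffI)
      fix x assume "x \<in> S"
      then obtain y where "wf (R x y)"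
        unfolding S_iff wf_R by blast
      then obtain h a where a: "a \<in> Field omega1" "\<And>s. h s \<in> underS omega1 a"
          "\<And>s t. (t, s) \<in> R x y \<Longrightarrow> (h t, h s) \<in> omega1 - Id"
        using wf_rank_omega1 by metis
      define e where "e s = to_nat_on (underS omega1 a) (h s)" for s
      have de: "d a (e s) = h s" for s
        unfolding d_def e_def using countable_underS_omega1[OF a(1)] a(2) by simp
      define w where "w n = (if even n then y (n div 2) else e (from_nat (n div 2)))" for n
      have "py w = y" "ph w = e"
        by (simp_all add: py_def ph_def w_def fun_eq_iff)
      then have "(x, w) \<in> Q a"
        unfolding Q_iff using a(3) by (auto simp: de)
      then show "x \<in> (\<Union>a\<in>Field omega1. fst ` Q a)"
        using a(1) by force
    next
      fix x assume "x \<in> (\<Union>a\<in>Field omega1. fst ` Q a)"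
      then obtain a w where "(x, w) \<in> Q a" by auto
      then have "R x (py w) \<subseteq> inv_image (omega1 - Id) (\<lambda>s. d a (ph w s))"
        unfolding Q_iff by auto
      then have "wf (R x (py w))"
        using wf_subset wf_inv_image wf_omega1 by blast
      then show "x \<in> S"
        unfolding S_iff wf_R by blast
    qed
  qed
qed

section \<open>Borel codes of fibres\<close>

text \<open>Substituting \<phi> into the first coordinate commutes with complements and with both
  projections, and it keeps the innermost set closed.\<close>

lemma sigma12_vimage:
  assumes "sigma12 S" "continuous_on UNIV \<phi>"
  shows "sigma12 (\<phi> -` S)"
proof -
  obtain T where T: "pi11 T" "S = fst ` (T :: ('a \<times> baire) set)"
    using assms(1) unfolding sigma12_def by blast
  obtain C :: "(('a \<times> baire) \<times> baire) set" where C: "closed C" "- T = fst ` C"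
    using T(1) unfolding pi11_def sigma11_def by blast
  define T' where "T' = (\<lambda>p. (\<phi> (fst p), snd p)) -` T"
  define C' where "C' = (\<lambda>p. ((\<phi> (fst (fst p)), snd (fst p)), snd p)) -` C"
  have cont: "continuous_on UNIV (\<lambda>p. \<phi> (fst (fst p)))"
    by (rule continuous_on_compose2[OF assms(2)]) (auto intro!: continuous_intros)
  have "closed C'"
    unfolding C'_def by (rule closed_vimage[OF C(1)]) (intro continuous_intros cont)
  moreover have "- T' = fst ` C'"
  proof (intro set_eqI)
    fix p :: "'b \<times> baire"
    have "p \<in> - T' \<longleftrightarrow> (\<phi> (fst p), snd p) \<in> fst ` C"
      by (simp add: T'_def flip: C(2))
    also have "\<dots> \<longleftrightarrow> (\<exists>z. ((\<phi> (fst p), snd p), z) \<in> C)" by force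
    also have "\<dots> \<longleftrightarrow> (\<exists>z. (p, z) \<in> C')" by (simp add: C'_def)
    also have "\<dots> \<longleftrightarrow> p \<in> fst ` C'" by force
    finally show "p \<in> - T' \<longleftrightarrow> p \<in> fst ` C'" .
  qed
  moreover have "\<phi> -` S = fst ` T'"
  proof (intro set_eqI)
    fix x
    have "x \<in> \<phi> -` S \<longleftrightarrow> (\<exists>y. (\<phi> x, y) \<in> T)" unfolding T(2) by force
    also have "\<dots> \<longleftrightarrow> (\<exists>y. (x, y) \<in> T')" by (simp add: T'_def)
    also have "\<dots> \<longleftrightarrow> x \<in> fst ` T'" by force
    finally show "x \<in> \<phi> -` S \<longleftrightarrow> x \<in> fst ` T'" .
  qed
  ultimately show ?thesis
    unfolding sigma12_def pi11_def sigma11_def by blast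
qed

text \<open>The leading bits are the tag that \<open>bcode\<close> uses for complements. An explicit
  operation, rather than mere existence of a code, is what later allows codes to vary continuously
  with a parameter.\<close>

definition code_compl :: "cantor \<Rightarrow> cantor" where
  "code_compl c k = (case k of 0 \<Rightarrow> True | Suc 0 \<Rightarrow> False | Suc (Suc j) \<Rightarrow> c j)"

definition code_union :: "(nat \<Rightarrow> cantor) \<Rightarrow> cantor" where
  "code_union cs k = (case k of 0 \<Rightarrow> False | Suc 0 \<Rightarrow> True
     | Suc (Suc j) \<Rightarrow> cs (fst (prod_decode j)) (snd (prod_decode j)))"

lemma bcode_code_compl: "bcode c B \<Longrightarrow> bcode (code_compl c) (- B)"
  by (rule bcode.compl) (simp_all add: code_compl_def)

lemma bcode_code_union: "(\<And>n. bcode (cs n) (B n)) \<Longrightarrow> bcode (code_union cs) (\<Union>n. B n)"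
  by (rule bcode.union) (simp_all add: code_union_def)

text \<open>The first two bits tell the three rules apart (both are false in a basic code), and the
  remaining bits determine the subcodes. Hence it makes sense to speak of the set coded by
  \<open>c\<close>.\<close>

lemma bcode_unique:
  assumes "bcode c B" "bcode c B'"
  shows "B = B'"
  using assms
proof (induction arbitrary: B' rule: bcode.induct)
  case (basic n)
  from basic.prems show ?case
  proof cases
    case (basic n')
    then have "n = n'" by (metis add_right_cancel)
    then show ?thesis using basic by simp
  qed (auto simp: fun_eq_iff)
next
  case (compl c B)
  from compl.prems show ?case
  proof cases
    case (compl B'')
    then show ?thesis using compl.IH by blast
  qed (use compl.hyps in auto)
next
  case (union c B)
  from union.prems show ?case
  proof cases
    case (union B'')
    then have "B n = B'' n" for n using union.IH by blast
    then show ?thesis using union by simp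
  qed (use union.hyps in auto)
qed

section \<open>The sets with codes are exactly the Borel sets\<close>

lemma bcode_Compl: "\<exists>c. bcode c B \<Longrightarrow> \<exists>c. bcode c (- B)"
  using bcode_code_compl by blast

lemma bcode_UN:
  assumes "\<And>n::nat. \<exists>c. bcode c (B n)"
  shows "\<exists>c. bcode c (\<Union>n. B n)"
proof -
  obtain cs where "\<And>n. bcode (cs n) (B n)" using assms by metis
  then show ?thesis using bcode_code_union by blast
qed

lemma bcode_Un:
  assumes "\<exists>c. bcode c A" "\<exists>c. bcode c B"
  shows "\<exists>c. bcode c (A \<union> B)"
proof -
  have "\<exists>c. bcode c (\<Union>n::nat. if n = 0 then A else B)"
    using assms by (intro bcode_UN) auto
  moreover have "(\<Union>n::nat. if n = 0 then A else B) = A \<union> B"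
    by (auto split: if_splits)
  ultimately show ?thesis by simp
qed

lemma bcode_basic: "\<exists>c. bcode c {x. x n}"
  using bcode.basic by blast

lemma bcode_UNIV: "\<exists>c. bcode c UNIV"
  using bcode_Un[OF bcode_basic bcode_Compl[OF bcode_basic]] by (metis Compl_partition)

lemma bcode_Int:
  assumes "\<exists>c. bcode c A" "\<exists>c. bcode c B"
  shows "\<exists>c. bcode c (A \<inter> B)"
  using bcode_Compl[OF bcode_Un[OF bcode_Compl[OF assms(1)] bcode_Compl[OF assms(2)]]]
  by simp

lemma bcode_cylinder: "\<exists>c. bcode c {x. \<forall>i<n. x i = u i}"
proof (induction n)
  case 0
  then show ?case using bcode_UNIV by simp
next
  case (Suc n)
  have "\<exists>c. bcode c {x. x n = u n}"
  proof (cases "u n")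
    case True
    then show ?thesis using bcode_basic by simp
  next
    case False
    then show ?thesis using bcode_Compl[OF bcode_basic[of n]] by (simp add: Collect_neg_eq)
  qed
  moreover have "{x. \<forall>i<Suc n. x i = u i} = {x. \<forall>i<n. x i = u i} \<inter> {x. x n = u n}"
    by (auto simp: less_Suc_eq)
  ultimately show ?case using bcode_Int[OF Suc] by simp
qed

lemma bcode_open:
  assumes "open S"
  shows "\<exists>c. bcode c S"
proof -
  define cyl where "cyl u = {x :: cantor. \<forall>i<length u. x i = u ! i}" for u
  \<comment> \<open>An enumeration of all cylinders, with those not inside \<open>S\<close> replaced
    by the empty set.\<close>
  define B where "B n = (let u = from_nat n in if cyl u \<subseteq> S then cyl u else {})" for n
  have "\<exists>c. bcode c (B n)" for n
    using bcode_cylinder bcode_Compl[OF bcode_UNIV] by (simp add: B_def Let_def cyl_def)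
  then have "\<exists>c. bcode c (\<Union>n. B n)" by (rule bcode_UN)
  moreover have "(\<Union>n. B n) = S"
  proof (intro subset_antisym subsetI)
    fix x assume "x \<in> (\<Union>n. B n)"
    then show "x \<in> S" by (auto simp: B_def Let_def split: if_splits)
  next
    fix x assume x: "x \<in> S"
    obtain n where n: "\<And>y. (\<forall>i<n. y i = x i) \<Longrightarrow> y \<in> S"
      using open_imp_agree_below[OF assms x] by metis
    define u where "u = map x [0..<n]"
    have "cyl u \<subseteq> S"
      using n by (auto simp: cyl_def u_def)
    moreover have "x \<in> cyl u" by (simp add: cyl_def u_def)
    ultimately have "x \<in> B (to_nat u)" by (simp add: B_def)
    then show "x \<in> (\<Union>n. B n)" by blast
  qed
  ultimately show ?thesis by simp
qed

lemma borel_imp_bcode: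
  assumes "B \<in> sets (borel :: cantor measure)"
  shows "\<exists>c. bcode c B"
proof -
  have "B \<in> sigma_sets UNIV {S. open S}"
    using assms by (simp add: borel_def)
  then show ?thesis
  proof (induction rule: sigma_sets.induct)
    case Empty
    then show ?case using bcode_Compl[OF bcode_UNIV] by simp
  next
    case (Compl a)
    then show ?case using bcode_Compl by (simp add: Compl_eq_Diff_UNIV)
  next
    case (Union a)
    then show ?case by (intro bcode_UN)
  qed (auto intro: bcode_open)
qed

lemma borel_coordinate: "{x :: cantor. x n} \<in> sets borel"
proof -
  have "open ((\<lambda>x::cantor. x n) -` {True})"
    by (rule open_vimage) (auto intro: open_discrete)
  moreover have "(\<lambda>x::cantor. x n) -` {True} = {x. x n}" by auto
  ultimately show ?thesis by simp
qed

lemma bcode_imp_borel: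
  assumes "bcode c B"
  shows "B \<in> sets borel"
  using assms by (induction rule: bcode.induct) (auto intro: borel_coordinate)

text \<open>The complement of the fibre over \<open>x\<close> is the union over \<open>n\<close> of
  the sets where \<open>f z n\<close> differs from \<open>x n\<close>. Each of these is one of two
  complementary sets with fixed codes, and bit \<open>n\<close> of \<open>x\<close> merely selects
  which code is used.\<close>

lemma continuous_code_of_fibre:
  fixes f :: "cantor \<Rightarrow> cantor"
  assumes f: "f \<in> borel_measurable borel"
  obtains \<phi> :: "cantor \<Rightarrow> cantor"
    where "continuous_on UNIV \<phi>" "\<And>x. bcode (\<phi> x) (f -` {x})"
proof -
  have "{z. f z n} \<in> sets borel" for n
    using measurable_sets[OF f borel_coordinate[of n]] by (simp add: vimage_def)
  then have "\<forall>n. \<exists>c. bcode c {z. f z n}"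
    by (intro allI borel_imp_bcode)
  then obtain a where "\<forall>n. bcode (a n) {z. f z n}"
    by (rule choice[THEN exE])
  then have a: "bcode (a n) {z. f z n}" for n ..
  define cs where "cs x n = (if x n then code_compl (a n) else a n)" for x n
  define \<phi> where "\<phi> x = code_compl (code_union (cs x))" for x
  show thesis
  proof
    have "bcode (cs x n) {z. f z n \<noteq> x n}" for x n
      using a[of n] bcode_code_compl[OF a[of n]] by (simp add: cs_def Collect_neg_eq)
    then have "bcode (\<phi> x) (- (\<Union>n. {z. f z n \<noteq> x n}))" for x
      unfolding \<phi>_def by (intro bcode_code_compl bcode_code_union)
    moreover have "- (\<Union>n. {z. f z n \<noteq> x n}) = f -` {x}" for x
      by (auto simp: fun_eq_iff)
    ultimately show "bcode (\<phi> x) (f -` {x})" for x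
      by simp
    show "continuous_on UNIV \<phi>"
    proof (rule continuous_on_finite_dependence)
      fix i
      \<comment> \<open>The complement tag and the union tag take four bits. Beyond them, bit
        \<open>i\<close> reads one entry of one column of the union code; for \<open>i < 4\<close>
        the bit is constant, so the truncated subtraction does no harm.\<close>
      define n where "n = Suc (fst (prod_decode (i - 4)))"
      have "\<phi> y i = \<phi> x i" if "\<forall>j<n. y j = x j" for x y
        using that by (simp add: \<phi>_def code_compl_def code_union_def cs_def n_def split: nat.split)
      then show "\<exists>n. \<forall>x y. (\<forall>j<n. y j = x j) \<longrightarrow> \<phi> y i = \<phi> x i" by blast
    qed
  qed
qed

section \<open>Perfectly many large fibres\<close>

lemma perfect_set_range_embedding:
  fixes k :: "cantor \<Rightarrow> cantor"
  assumes cont: "continuous_on UNIV k" and "inj k"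
  shows "perfect_set (range k)"
  unfolding perfect_set_def
proof
  show "closed (range k)"
    using closed_image_cantor[OF cont closed_UNIV] .
  show "\<forall>x\<in>range k. x islimpt range k"
  proof
    fix x assume "x \<in> range k"
    then obtain b where b: "x = k b" by blast
    show "x islimpt range k"
      unfolding islimpt_def
    proof (intro allI impI)
      fix T assume T: "x \<in> T" "open T"
      have "open (k -` T)"
        using T(2) cont by (rule open_vimage)
      moreover have "b \<in> k -` T" using T(1) b by simp
      ultimately obtain n where n: "\<And>y. (\<forall>i<n. y i = b i) \<Longrightarrow> y \<in> k -` T"
        using open_imp_agree_below[of "k -` T" b] by blast
      \<comment> \<open>Flipping the bit at \<open>n\<close> keeps the first \<open>n\<close> bits,
        so the image stays in \<open>T\<close>, while injectivity moves it off
        \<open>x\<close>.\<close>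
      define b' where "b' = b(n := \<not> b n)"
      have "k b' \<in> T" using n[of b'] by (simp add: b'_def)
      moreover have "b' \<noteq> b" by (auto simp: b'_def fun_eq_iff)
      then have "k b' \<noteq> x" using \<open>inj k\<close> b by (simp add: inj_eq)
      ultimately show "\<exists>y\<in>range k. y \<in> T \<and> y \<noteq> x" by blast
    qed
  qed
qed

text \<open>Following \<open>f\<close> by the inverse of \<open>k\<close>, with a constant value off
  the range of \<open>k\<close>, gives a map whose fibre over \<open>b\<close> contains the fibre of
  \<open>f\<close> over \<open>k b\<close>.\<close>

lemma property_M_of_embedding:
  fixes k :: "cantor \<Rightarrow> cantor"
  assumes I: "borel_ideal I" and f: "f \<in> borel_measurable borel"
    and cont: "continuous_on UNIV k" and "inj k"
    and fibre: "\<And>b. f -` {k b} \<notin> I"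
  shows "property_M I"
proof -
  let ?c = "\<lambda>_::nat. False"
  define g where "g z = (if f z \<in> range k then inv k (f z) else ?c)" for z
  have f_vimage: "f -` B \<in> sets borel" if "B \<in> sets borel" for B
    using measurable_sets[OF f that] by simp
  have closed_k: "k ` D \<in> sets borel" if "closed D" for D
    using closed_image_cantor[OF cont that] by simp
  have "g \<in> borel_measurable borel"
  proof (rule borel_measurableI)
    fix S :: "cantor set" assume "open S"
    \<comment> \<open>By injectivity, the image of an open set is a difference of two closed images,
      hence Borel.\<close>
    have "k ` S = range k - k ` (- S)"
      using \<open>inj k\<close> by (auto simp: inj_eq)
    then have kS: "k ` S \<in> sets borel"
      using closed_k[of UNIV] closed_k[of "- S"] \<open>open S\<close> by auto
    \<comment> \<open>The second part collects the points sent to the default value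
      \<open>?c\<close>.\<close>
    have "g -` S = f -` (k ` S) \<union> (if ?c \<in> S then - f -` range k else {})"
      using \<open>inj k\<close> by (auto simp: g_def split: if_splits)
    moreover have "\<dots> \<in> sets borel"
      using f_vimage[OF kS] f_vimage[OF closed_k[of UNIV]] by auto
    ultimately show "g -` S \<inter> space borel \<in> sets borel" by simp
  qed
  moreover have "g -` {b} \<notin> I" for b
  proof
    assume "g -` {b} \<in> I"
    moreover have "f -` {k b} \<subseteq> g -` {b}"
      using \<open>inj k\<close> by (auto simp: g_def)
    \<comment> \<open>An ideal passes only to Borel subsets, so the fibre must be known to be Borel;
      its code shows this.\<close>
    moreover obtain c where "bcode c (f -` {k b})"
      using continuous_code_of_fibre[OF f] by metis
    then have "f -` {k b} \<in> sets borel" by (rule bcode_imp_borel)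
    ultimately show False
      using I fibre unfolding borel_ideal_def by blast
  qed
  ultimately show ?thesis unfolding property_M_def by blast
qed

theorem theorem4p5:
  fixes I :: "cantor set set" and f :: "cantor \<Rightarrow> cantor"
    and xs :: "'i \<Rightarrow> cantor" and A :: "'i set"
  assumes "borel_ideal I"
    and "has_pi12_definition I"
    and "f \<in> borel_measurable borel"
    and "(card_of A, omega2) \<in> ordIso"
    and "inj_on xs A"
    and "\<forall>\<alpha>\<in>A. f -` {xs \<alpha>} \<notin> I"
  shows "(\<exists>P :: cantor set. P \<noteq> {} \<and> perfect_set P \<and> (\<forall>x\<in>P. f -` {x} \<notin> I))
         \<and> property_M I"
proof -
  define D where "D = {a :: cantor. \<exists>B. bcode a B \<and> B \<in> I}"
  obtain \<phi> :: "cantor \<Rightarrow> cantor"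
    where cont: "continuous_on UNIV \<phi>" and code: "\<And>x. bcode (\<phi> x) (f -` {x})"
    using continuous_code_of_fibre[OF assms(3)] by blast
  \<comment> \<open>Since a code determines its set, the set witnessing membership in
    \<open>D\<close> is the fibre itself.\<close>
  have D_iff: "\<phi> x \<in> D \<longleftrightarrow> f -` {x} \<in> I" for x
  proof
    assume "\<phi> x \<in> D"
    then obtain B where "bcode (\<phi> x) B" "B \<in> I" unfolding D_def mem_Collect_eq by (elim exE conjE)
    then show "f -` {x} \<in> I" using bcode_unique[OF code] by metis
  next
    assume "f -` {x} \<in> I"
    then show "\<phi> x \<in> D" unfolding D_def mem_Collect_eq using code[of x] by (intro exI conjI)
  qed
  have "sigma12 (- D)"
    using assms(2) unfolding has_pi12_definition_def pi12_def D_def .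
  then have "sigma12 (\<phi> -` (- D))"
    using cont by (rule sigma12_vimage)
  then obtain Y :: "nat set \<Rightarrow> cantor set"
    where Y: "\<And>a. sigma11 (Y a)" "\<phi> -` (- D) = (\<Union>a\<in>Field omega1. Y a)"
    using sigma12_eq_Union_sigma11[of "\<phi> -` (- D)"] by blast
  have "\<exists>a\<in>Field omega1. uncountable (Y a)"
  proof (rule ccontr)
    assume contra: "\<not> ?thesis"
    \<comment> \<open>If all pieces were countable, their union over \<open>omega1\<close> would
      have size at most that of \<open>omega1\<close>, yet \<open>xs\<close> maps \<open>A\<close>,
      of size \<open>omega2\<close>, injectively into it.\<close>
    have le: "(natLeq, card_of (Field omega1)) \<in> ordLeq"
      using infinite_Field_omega1 infinite_iff_natLeq_ordLeq by blast
    have "\<forall>a\<in>Field omega1. (card_of (Y a), card_of (Field omega1)) \<in> ordLeq"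
    proof
      fix a assume "a \<in> Field omega1"
      then have "(card_of (Y a), natLeq) \<in> ordLeq"
        using contra by (simp flip: countable_card_le_natLeq)
      then show "(card_of (Y a), card_of (Field omega1)) \<in> ordLeq"
        using le by (rule ordLeq_transitive)
    qed
    then have "(card_of (\<phi> -` (- D)), card_of (Field omega1)) \<in> ordLeq"
      unfolding Y(2)
      by (intro card_of_UNION_ordLeq_infinite infinite_Field_omega1)
        (simp_all add: ordLeq_refl card_of_Card_order)
    moreover have "xs ` A \<subseteq> \<phi> -` (- D)"
      using assms(6) by (auto simp: D_iff)
    then have "(card_of A, card_of (\<phi> -` (- D))) \<in> ordLeq"
      using assms(5) card_of_ordLeq by blast
    ultimately have "(card_of A, card_of (Field omega1)) \<in> ordLeq"
      using ordLeq_transitive by blast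
    then have "(card_of A, omega1) \<in> ordLeq"
      using card_of_Field_ordIso[OF Card_order_omega1] ordLeq_ordIso_trans by blast
    moreover have "(omega1, card_of A) \<in> ordLess"
      using cardSuc_greater[OF Card_order_omega1] ordIso_symmetric[OF assms(4)]
      unfolding omega2_def by (rule ordLess_ordIso_trans)
    ultimately show False
      using not_ordLess_ordLeq by blast
  qed
  then obtain a where a: "a \<in> Field omega1" "uncountable (Y a)" ..
  obtain k :: "cantor \<Rightarrow> cantor"
    where k: "continuous_on UNIV k" "inj k" "range k \<subseteq> Y a"
    by (rule sigma11_uncountable_imp_cantor_embedding[OF Y(1) a(2)])
  have "range k \<subseteq> \<phi> -` (- D)"
    unfolding Y(2) using k(3) UN_upper[OF a(1)] by (rule subset_trans)
  then have fibre: "f -` {k b} \<notin> I" for b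
    using D_iff by blast
  have "range k \<noteq> {} \<and> perfect_set (range k) \<and> (\<forall>x\<in>range k. f -` {x} \<notin> I)"
    using perfect_set_range_embedding[OF k(1,2)] fibre by simp
  moreover have "property_M I"
    using property_M_of_embedding[OF assms(1,3) k(1,2) fibre] .
  ultimately show ?thesis by (intro conjI[OF exI[of _ "range k"]])
qed

end
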